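(* Let $\Bbbk$ be an uncountable algebraically closed field of characteristic zero, $\mathfrak{sq}=\mathfrak{sq}_2$, and let $\mathtt a=\mathfrak{sl}_2(\Bbbk)\subset\mathtt g=\mathfrak{gl}_2(\Bbbk)=\mathfrak{sq}_{\overline 0}$ be viewed as a (purely even) subsuperalgebra of $\mathfrak{sq}$. The restriction functor from $\mathfrak{sq}$-supermodules to $\mathtt a$-modules induces a bijection between the set of isomorphism classes (up to parity change) of simple atypical $\mathfrak{sq}$-supermodules and the set of isomorphism classes of simple purely even $\mathtt a$-(super)modules.
   Context: The queer Lie superalgebra $\mathfrak q=\mathfrak q_2$ consists of the block matrices $\mathtt M(A,B)=\begin{pmatrix}A&B\\ B&A\end{pmatrix}$, $A,B\in\mathfrak{gl}_2(\Bbbk)$; the even part consists of the $\mathtt M(A,0)$ and is identified with $\mathtt g=\mathfrak{gl}_2(\Bbbk)$, the odd part consists of the $\mathtt M(0,B)$; the superbracket is $[X,Y]=XY-(-1)^{\overline X\,\overline Y}YX$ for homogeneous $X,Y$. With matrix units $E_{ij}$ put $H_i=\mathtt M(E_{ii},0)$, $\overline E=\mathtt M(0,E_{12})$, $\overline F=\mathtt M(0,E_{21})$, $\overline H_i=\mathtt M(0,E_{ii})$. The subsuperalgebra $\mathfrak{sq}=\mathfrak{sq}_2$ of $\mathfrak q$ is generated by $\mathtt g$ and the elements $\overline E$, $\overline F$, $\overline H_1-\overline H_2$. Supermodules are $\mathbb Z/2\mathbb Z$-graded, homomorphisms are of degree zero, simple supermodules are those without proper nonzero graded subsupermodules. A simple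 $\mathfrak{sq}$-supermodule is called atypical if the central element $H_1+H_2$ acts on it as zero. The bijection is to be understood as follows: each class, up to isomorphism and parity change, of simple atypical $\mathfrak{sq}$-supermodules has a representative whose restriction to $\mathtt a$ is a simple purely even $\mathtt a$-module, and the class is sent to the isomorphism class of this $\mathtt a$-module. *)

theory Defs
  imports "HOL-Analysis.Analysis" "HOL-Algebra.Algebraic_Closure_Type" "HOL-Library.Z2"
begin

no_notation var (\<open>X\<index>\<close>)
unbundle no fps_syntax

text \<open>Parities are elements of the field \<open>bit\<close> with two elements. The index type
  \<open>2 + 2\<close> is a disjoint sum, so that \<open>Inl\<close> and \<open>Inr\<close> single out the two blocks.\<close>

type_synonym 'k mat2 = "'k ^ 2 ^ 2"
type_synonym 'k mat22 = "'k ^ (2 + 2) ^ (2 + 2)"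

definition qM :: "'k mat2 \<Rightarrow> 'k mat2 \<Rightarrow> 'k mat22" where
  "qM A B = (\<chi> r s. case (r, s) of
      (Inl i, Inl j) \<Rightarrow> A $ i $ j | (Inl i, Inr j) \<Rightarrow> B $ i $ j
    | (Inr i, Inl j) \<Rightarrow> B $ i $ j | (Inr i, Inr j) \<Rightarrow> A $ i $ j)"

definition mscale :: "'k::times \<Rightarrow> 'k ^ 'n ^ 'm \<Rightarrow> 'k ^ 'n ^ 'm" where
  "mscale c X = (\<chi> i j. c * X $ i $ j)"

definition parity_sign :: "bit \<Rightarrow> bit \<Rightarrow> 'a::ring_1" where
  "parity_sign p q = (if p * q = 1 then -1 else 1)"

text \<open>The superbracket of \<open>X\<close>, homogeneous of parity \<open>p\<close>, and \<open>Y\<close>, homogeneous of parity \<open>q\<close>.\<close>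

definition sbracket :: "bit \<Rightarrow> bit \<Rightarrow> 'k::ring_1 mat22 \<Rightarrow> 'k mat22 \<Rightarrow> 'k mat22" where
  "sbracket p q X Y = X ** Y - mscale (parity_sign p q) (Y ** X)"

text \<open>A graded subspace of the space of block matrices is given by its homogeneous components,
  a function from parities to sets of matrices; \<open>total\<close> is the sum of the two components.\<close>

definition total :: "(bit \<Rightarrow> 'k::ring_1 mat22 set) \<Rightarrow> 'k mat22 set" where
  "total L = {X + Y | X Y. X \<in> L 0 \<and> Y \<in> L 1}"

definition E2 :: "2 \<Rightarrow> 2 \<Rightarrow> 'k::ring_1 mat2" where
  "E2 i j = (\<chi> r s. if r = i \<and> s = j then 1 else 0)"

definition H :: "2 \<Rightarrow> 'k::ring_1 mat22" where "H i = qM (E2 i i) 0"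
definition Hbar :: "2 \<Rightarrow> 'k::ring_1 mat22" where "Hbar i = qM 0 (E2 i i)"
definition Ebar :: "'k::ring_1 mat22" where "Ebar = qM 0 (E2 1 2)"
definition Fbar :: "'k::ring_1 mat22" where "Fbar = qM 0 (E2 2 1)"

text \<open>\<open>sq_hom p X\<close>: \<open>X\<close> lies in the parity-\<open>p\<close> component of the smallest graded subspace that
  contains the generators and is closed under the superbracket.\<close>

inductive sq_hom :: "bit \<Rightarrow> 'k::ring_1 mat22 \<Rightarrow> bool" where
  gl2: "sq_hom 0 (qM A 0)"
| Ebar: "sq_hom 1 Ebar"
| Fbar: "sq_hom 1 Fbar"
| Hbar: "sq_hom 1 (Hbar 1 - Hbar 2)"
| zero: "sq_hom p 0"
| add: "sq_hom p X \<Longrightarrow> sq_hom p Y \<Longrightarrow> sq_hom p (X + Y)"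
| scale: "sq_hom p X \<Longrightarrow> sq_hom p (mscale c X)"
| bracket: "sq_hom p X \<Longrightarrow> sq_hom q Y \<Longrightarrow> sq_hom (p + q) (sbracket p q X Y)"

definition sq2 :: "bit \<Rightarrow> 'k::ring_1 mat22 set" where
  "sq2 p = {X. sq_hom p X}"

definition sl2 :: "bit \<Rightarrow> 'k::ring_1 mat22 set" where
  "sl2 p = (if p = 0 then {qM A 0 | A. trace A = 0} else {0})"

text \<open>The carrier of a supermodule is a subset of an arbitrary type. The multiplicative fields
  that the record type \<open>module\<close> inherits from \<open>ring\<close> are irrelevant. Only the values of
  \<open>act\<close> on \<open>total L \<times> carrier M\<close> matter.\<close>

record ('k, 'v) smod = "('k, 'v) module" +
  part :: "bit \<Rightarrow> 'v set"
  act :: "'k mat22 \<Rightarrow> 'v \<Rightarrow> 'v"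

definition graded_submodule :: "'v set \<Rightarrow> ('k::field, 'v) smod \<Rightarrow> bool" where
  "graded_submodule W M \<longleftrightarrow> submodule W ring_of_type_algebra M \<and>
     W = (W \<inter> part M 0) <+>\<^bsub>M\<^esub> (W \<inter> part M 1)"

locale supermodule = Module.module ring_of_type_algebra M
  for L :: "bit \<Rightarrow> 'k::field mat22 set" and M :: "('k, 'v) smod" (structure) +
  assumes part_submodule: "submodule (part M p) ring_of_type_algebra M"
    and part_sum: "part M 0 <+> part M 1 = carrier M"
    and part_inter: "part M 0 \<inter> part M 1 = {\<zero>}"
    and act_add: "X \<in> total L \<Longrightarrow> v \<in> carrier M \<Longrightarrow> w \<in> carrier M \<Longrightarrow>
        act M X (v \<oplus> w) = act M X v \<oplus> act M X w"
    and act_smult: "X \<in> total L \<Longrightarrow> v \<in> carrier M \<Longrightarrow> act M X (c \<odot> v) = c \<odot> act M X v"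
    and add_act: "X \<in> total L \<Longrightarrow> Y \<in> total L \<Longrightarrow> v \<in> carrier M \<Longrightarrow>
        act M (X + Y) v = act M X v \<oplus> act M Y v"
    and scale_act: "X \<in> total L \<Longrightarrow> v \<in> carrier M \<Longrightarrow> act M (mscale c X) v = c \<odot> act M X v"
    and act_part: "X \<in> L p \<Longrightarrow> v \<in> part M q \<Longrightarrow> act M X v \<in> part M (p + q)"
    and act_sbracket: "X \<in> L p \<Longrightarrow> Y \<in> L q \<Longrightarrow> v \<in> carrier M \<Longrightarrow>
        act M (sbracket p q X Y) v =
          act M X (act M Y v) \<ominus> parity_sign p q \<odot> act M Y (act M X v)"

definition subsupermodule ::
  "(bit \<Rightarrow> 'k::field mat22 set) \<Rightarrow> 'v set \<Rightarrow> ('k, 'v) smod \<Rightarrow> bool" where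
  "subsupermodule L W M \<longleftrightarrow> graded_submodule W M \<and> (\<forall>X\<in>total L. \<forall>w\<in>W. act M X w \<in> W)"

definition simple_supermodule ::
  "(bit \<Rightarrow> 'k::field mat22 set) \<Rightarrow> ('k, 'v) smod \<Rightarrow> bool" where
  "simple_supermodule L M \<longleftrightarrow> supermodule L M \<and> carrier M \<noteq> {\<zero>\<^bsub>M\<^esub>} \<and>
     (\<forall>W. subsupermodule L W M \<longrightarrow> W = {\<zero>\<^bsub>M\<^esub>} \<or> W = carrier M)"

definition supermodule_hom ::
  "(bit \<Rightarrow> 'k::field mat22 set) \<Rightarrow> ('k, 'v) smod \<Rightarrow> ('k, 'w) smod \<Rightarrow> ('v \<Rightarrow> 'w) set" where
  "supermodule_hom L M N = {f \<in> hom (add_monoid M) (add_monoid N).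
     (\<forall>c. \<forall>v\<in>carrier M. f (c \<odot>\<^bsub>M\<^esub> v) = c \<odot>\<^bsub>N\<^esub> f v) \<and>
     (\<forall>p. f ` part M p \<subseteq> part N p) \<and>
     (\<forall>X\<in>total L. \<forall>v\<in>carrier M. f (act M X v) = act N X (f v))}"

definition supermodule_isomorphic ::
  "(bit \<Rightarrow> 'k::field mat22 set) \<Rightarrow> ('k, 'v) smod \<Rightarrow> ('k, 'w) smod \<Rightarrow> bool" where
  "supermodule_isomorphic L M N \<longleftrightarrow>
     (\<exists>f\<in>supermodule_hom L M N. bij_betw f (carrier M) (carrier N))"

text \<open>Parity change keeps the action. The variant in which an odd element acts with an additional
  sign is isomorphic to this one via \<open>v \<mapsto> (-1)\<^bsup>p\<^esup> v\<close> on the component of parity \<open>p\<close>.\<close>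

definition parity_change :: "('k, 'v) smod \<Rightarrow> ('k, 'v) smod" where
  "parity_change M = M\<lparr>part := \<lambda>p. part M (p + 1)\<rparr>"

definition purely_even :: "('k, 'v) smod \<Rightarrow> bool" where
  "purely_even M \<longleftrightarrow> part M 1 = {\<zero>\<^bsub>M\<^esub>}"

definition Res :: "(bit \<Rightarrow> 'k::ring_1 mat22 set) \<Rightarrow> ('k, 'v) smod \<Rightarrow> ('k, 'v) smod" where
  "Res L M = M\<lparr>act := restrict (act M) (total L)\<rparr>"

definition atypical :: "('k::field, 'v) smod \<Rightarrow> bool" where
  "atypical M \<longleftrightarrow> (\<forall>v\<in>carrier M. act M (H 1 + H 2) v = \<zero>\<^bsub>M\<^esub>)"

definition simple_atypical :: "('k::field, 'v) smod set" where
  "simple_atypical = {M. simple_supermodule sq2 M \<and> atypical M}"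

definition iso_up_to_parity :: "(('k::field, 'v) smod \<times> ('k, 'v) smod) set" where
  "iso_up_to_parity = {(M, N). M \<in> simple_atypical \<and> N \<in> simple_atypical \<and>
     (supermodule_isomorphic sq2 M N \<or> supermodule_isomorphic sq2 M (parity_change N))}"

definition simple_even_sl2 :: "('k::field, 'v) smod set" where
  "simple_even_sl2 = {N. simple_supermodule sl2 N \<and> purely_even N}"

definition iso_sl2 :: "(('k::field, 'v) smod \<times> ('k, 'v) smod) set" where
  "iso_sl2 = {(M, N). M \<in> simple_even_sl2 \<and> N \<in> simple_even_sl2 \<and>
     supermodule_isomorphic sl2 M N}"

end

theory Submission
  imports Defs
begin

text \<open>The even part of \<open>sq2\<close> is all of \<open>gl2\<close> and its odd part consists of the \<open>qM 0 B\<close> with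
  \<open>trace B = 0\<close>; the bracket of two odd elements is \<open>trace (B ** B')\<close> times the central element
  \<open>H 1 + H 2\<close>. On an atypical supermodule the odd elements therefore anticommute and square to
  zero, so three odd generators have a common nonzero kernel vector. The common kernel of the odd
  part is a subsupermodule, hence on a simple atypical supermodule the odd part acts by zero, and
  only \<open>sl2\<close> acts. Then each homogeneous component is a subsupermodule, so the supermodule is
  concentrated in one parity. Conversely an \<open>sl2\<close>-module becomes an atypical \<open>sq2\<close>-supermodule
  by composing its action with the projection of \<open>sq2\<close> onto \<open>sl2\<close>.\<close>

text \<open>In \<open>Defs\<close>, \<open>fps_syntax\<close> names the bundle for Laurent series, so the notation \<open>$\<close> for
  coefficients of power series is still active there and makes matrix entries ambiguous.\<close>

no_notation fps_nth (infixl \<open>$\<close> 75)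

section \<open>The superalgebra of block matrices\<close>

lemma sum_UNIV_sum2:
  "sum f (UNIV :: (2 + 2) set) = f (Inl 1) + f (Inl 2) + (f (Inr 1) + f (Inr 2))"
proof -
  have "sum f (UNIV :: (2 + 2) set) = sum f (range Inl \<union> range Inr)"
    by (simp add: UNIV_sum)
  also have "\<dots> = sum f (range Inl) + sum f (range Inr)"
    by (rule sum.union_disjoint) auto
  also have "sum f (range Inl) = f (Inl 1) + f (Inl 2)"
    by (subst sum.reindex) (simp_all only: inj_Inl sum_2 o_apply)
  also have "sum f (range Inr) = f (Inr 1) + f (Inr 2)"
    by (subst sum.reindex) (simp_all only: inj_Inr sum_2 o_apply)
  finally show ?thesis .
qed

lemma mat22_eq_iff:
  fixes X Y :: "'k mat22"
  shows "X = Y \<longleftrightarrow> (\<forall>i j. X $ Inl i $ Inl j = Y $ Inl i $ Inl j \<and> X $ Inl i $ Inr j = Y $ Inl i $ Inr j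
     \<and> X $ Inr i $ Inl j = Y $ Inr i $ Inl j \<and> X $ Inr i $ Inr j = Y $ Inr i $ Inr j)"
proof
  assume *: "\<forall>i j. X $ Inl i $ Inl j = Y $ Inl i $ Inl j \<and> X $ Inl i $ Inr j = Y $ Inl i $ Inr j
     \<and> X $ Inr i $ Inl j = Y $ Inr i $ Inl j \<and> X $ Inr i $ Inr j = Y $ Inr i $ Inr j"
  have "X $ r $ s = Y $ r $ s" for r s
    using * by (cases r; cases s) simp_all
  then show "X = Y"
    by (simp add: vec_eq_iff)
qed simp

lemma qM_nth [simp]:
  "qM A B $ Inl i $ Inl j = A $ i $ j" "qM A B $ Inl i $ Inr j = B $ i $ j"
  "qM A B $ Inr i $ Inl j = B $ i $ j" "qM A B $ Inr i $ Inr j = A $ i $ j"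
  by (simp_all add: qM_def)

lemma mscale_nth [simp]: "mscale c X $ i $ j = c * X $ i $ j"
  by (simp add: mscale_def)

lemma mat_mult_nth_2:
  fixes A B :: "'k::semiring_1 mat2"
  shows "(A ** B) $ i $ j = A $ i $ 1 * B $ 1 $ j + A $ i $ 2 * B $ 2 $ j"
  by (simp add: matrix_matrix_mult_def sum_2)

lemma trace_2: "trace (A :: 'k::comm_semiring_1 mat2) = A $ 1 $ 1 + A $ 2 $ 2"
  by (simp add: trace_def sum_2)

lemma trace_zero [simp]: "trace (0 :: 'k::comm_semiring_1 mat2) = 0"
  by (simp add: trace_2)

lemma trace_mscale: "trace (mscale c A) = c * trace A"
  for A :: "'k::comm_ring_1 mat2"
  by (simp add: trace_2 algebra_simps)

lemma qM_inject [simp]: "qM A B = qM A' B' \<longleftrightarrow> A = A' \<and> B = B'"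
  by (auto simp: mat22_eq_iff vec_eq_iff)

lemma qM_0 [simp]: "qM 0 0 = 0"
  by (simp add: mat22_eq_iff)

lemma qM_add: "qM A B + qM A' B' = qM (A + A') (B + B')"
  by (simp add: mat22_eq_iff)

lemma qM_diff: "qM A B - qM A' B' = qM (A - A') (B - B')"
  by (simp add: mat22_eq_iff)

lemma mscale_0 [simp]: "mscale c (0 :: 'k::ring_1 ^ 'n ^ 'm) = 0"
  by (simp add: vec_eq_iff)

lemma mscale_1 [simp]: "mscale 1 (X :: 'k::ring_1 ^ 'n ^ 'm) = X"
  by (simp add: vec_eq_iff)

lemma mscale_qM: "mscale c (qM A B) = qM (mscale c A) (mscale c B)"
  by (simp add: mat22_eq_iff)

lemma qM_mult: "qM A B ** qM A' B' = qM (A ** A' + B ** B') (A ** B' + B ** A')"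
  for A B :: "'k::comm_ring_1 mat2"
  by (simp add: mat22_eq_iff matrix_matrix_mult_def sum_UNIV_sum2 sum_2 algebra_simps)

lemma H_sum: "H 1 + H 2 = qM (mat 1) 0"
proof -
  have "E2 1 1 + E2 2 2 = (mat 1 :: 'a mat2)"
    by (simp add: E2_def vec_eq_iff mat_def forall_2)
  then show ?thesis
    by (simp add: H_def qM_add)
qed

lemma sbracket_even_even: "sbracket 0 0 (qM A 0) (qM A' 0) = qM (A ** A' - A' ** A) 0"
  and sbracket_even_odd: "sbracket 0 1 (qM A 0) (qM 0 B) = qM 0 (A ** B - B ** A)"
  and sbracket_odd_even: "sbracket 1 0 (qM 0 B) (qM A 0) = qM 0 (B ** A - A ** B)"
  for A A' B :: "'k::comm_ring_1 mat2"
  by (simp_all add: sbracket_def parity_sign_def qM_mult qM_diff mat22_eq_iff mat_mult_nth_2)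

text \<open>By Cayley-Hamilton a traceless \<open>B\<close> squares to a scalar matrix; polarising
  gives \<open>B ** B' + B' ** B = mat (trace (B ** B'))\<close>. The left side is the diagonal
  block of the superbracket, so the bracket is central.\<close>

lemma sbracket_odd_odd:
  fixes B B' :: "'k::comm_ring_1 mat2"
  assumes "trace B = 0" "trace B' = 0"
  shows "sbracket 1 1 (qM 0 B) (qM 0 B') = mscale (trace (B ** B')) (H 1 + H 2)"
proof -
  have "B $ 2 $ 2 = - B $ 1 $ 1" "B' $ 2 $ 2 = - B' $ 1 $ 1"
    using assms by (simp_all add: trace_2 eq_neg_iff_add_eq_0 add.commute)
  then show ?thesis
    by (simp add: sbracket_def parity_sign_def qM_mult qM_diff mat22_eq_iff mscale_qM H_sum
        forall_2 mat_def trace_2 mat_mult_nth_2 algebra_simps)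
qed

section \<open>The homogeneous components of \<open>sq2\<close> and \<open>sl2\<close>\<close>

lemma trace_commutator: "trace (A ** B - B ** A) = 0"
  for A B :: "'k::comm_ring_1 mat2"
  by (simp add: trace_sub trace_mul_sym[of A B])

text \<open>Vanishing trace of the odd block is an invariant of the generation process. In the
  bracket case, a mixed bracket yields a commutator, which is traceless, and a bracket of two odd
  elements is a multiple of \<open>H 1 + H 2\<close>, hence even.\<close>

lemma sq_hom_imp_qM:
  fixes X :: "'k::comm_ring_1 mat22"
  assumes "sq_hom p X"
  shows "\<exists>A. X = (if p = 0 then qM A 0 else qM 0 A) \<and> (p = 1 \<longrightarrow> trace A = 0)"
  using assms
proof induction
  case (bracket p X q Y)
  then obtain A B where "X = (if p = 0 then qM A 0 else qM 0 A)" "p = 1 \<longrightarrow> trace A = 0"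
      "Y = (if q = 0 then qM B 0 else qM 0 B)" "q = 1 \<longrightarrow> trace B = 0"
    by blast
  then show ?case
    by (cases p; cases q) (auto simp: sbracket_even_even sbracket_even_odd sbracket_odd_even
        sbracket_odd_odd trace_commutator H_sum mscale_qM)
next
  case Ebar
  show ?case by (auto simp: Defs.Ebar_def trace_2 E2_def)
next
  case Fbar
  show ?case by (auto simp: Defs.Fbar_def trace_2 E2_def)
next
  case Hbar
  show ?case by (auto simp: Defs.Hbar_def trace_2 E2_def qM_diff)
next
  case (add p X Y)
  then obtain A B where "X = (if p = 0 then qM A 0 else qM 0 A)" "p = 1 \<longrightarrow> trace A = 0"
      "Y = (if p = 0 then qM B 0 else qM 0 B)" "p = 1 \<longrightarrow> trace B = 0"
    by blast
  then show ?case
    by (intro exI[of _ "A + B"]) (auto simp: qM_add trace_add)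
next
  case (scale p X c)
  then obtain A where "X = (if p = 0 then qM A 0 else qM 0 A)" "p = 1 \<longrightarrow> trace A = 0"
    by blast
  then show ?case
    by (intro exI[of _ "mscale c A"]) (auto simp: mscale_qM trace_mscale)
next
  case (zero p)
  show ?case by (intro exI[of _ 0]) simp
next
  case (gl2 A)
  show ?case by (intro exI[of _ A]) simp
qed

text \<open>The three odd generators already span the traceless odd matrices. This gives the
  converse inclusion for \<open>sq2 1\<close>, and later reduces the vanishing of the whole odd part
  on a vector to three conditions.\<close>

lemma odd_basis:
  fixes B :: "'k::comm_ring_1 mat2"
  assumes "trace B = 0"
  shows "qM 0 B = mscale (B $ 1 $ 2) Ebar + mscale (B $ 2 $ 1) Fbar + mscale (B $ 1 $ 1) (Hbar 1 - Hbar 2)"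
proof -
  have "B $ 2 $ 2 = - B $ 1 $ 1"
    using assms by (simp add: trace_2 eq_neg_iff_add_eq_0 add.commute)
  then show ?thesis
    by (simp add: mat22_eq_iff forall_2 Ebar_def Fbar_def Hbar_def E2_def)
qed

lemma sq2_0_eq: "(sq2 0 :: 'k::comm_ring_1 mat22 set) = {qM A 0 | A. True}"
proof (intro equalityI subsetI)
  fix X :: "'k mat22"
  assume "X \<in> sq2 0"
  then show "X \<in> {qM A 0 | A. True}"
    using sq_hom_imp_qM[of 0 X] by (auto simp: sq2_def)
next
  fix X :: "'k mat22"
  assume "X \<in> {qM A 0 | A. True}"
  then show "X \<in> sq2 0"
    by (auto simp: sq2_def sq_hom.gl2)
qed

lemma sq2_1_eq: "(sq2 1 :: 'k::comm_ring_1 mat22 set) = {qM 0 B | B. trace B = 0}"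
proof (intro equalityI subsetI)
  fix X :: "'k mat22"
  assume "X \<in> sq2 1"
  then show "X \<in> {qM 0 B | B. trace B = 0}"
    using sq_hom_imp_qM[of 1 X] by (auto simp: sq2_def)
next
  fix X :: "'k mat22"
  assume "X \<in> {qM 0 B | B. trace B = 0}"
  then obtain B where B: "X = qM 0 B" "trace B = 0"
    by blast
  have "sq_hom 1 X"
    unfolding B(1) odd_basis[OF B(2)]
    by (intro sq_hom.add sq_hom.scale sq_hom.Ebar sq_hom.Fbar sq_hom.Hbar)
  then show "X \<in> sq2 1"
    by (simp add: sq2_def)
qed

lemma total_sq2_eq: "(total sq2 :: 'k::comm_ring_1 mat22 set) = {qM A B | A B. trace B = 0}"
proof (intro equalityI subsetI)
  fix X :: "'k mat22"
  assume "X \<in> {qM A B | A B. trace B = 0}"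
  then obtain A B where "X = qM A 0 + qM 0 B" "trace B = 0"
    by (auto simp: qM_add)
  then show "X \<in> total sq2"
    by (auto simp: total_def sq2_0_eq sq2_1_eq)
qed (auto simp: total_def sq2_0_eq sq2_1_eq qM_add)

lemma total_sl2_eq: "(total sl2 :: 'k::comm_ring_1 mat22 set) = {qM A 0 | A. trace A = 0}"
  by (auto simp: total_def sl2_def)

lemma subset_total: "0 \<in> L 0 \<Longrightarrow> 0 \<in> L 1 \<Longrightarrow> L p \<subseteq> total L"
  by (cases p) (force simp: total_def)+

lemma sq2_zero: "0 \<in> sq2 p"
  by (simp add: sq2_def sq_hom.zero)

lemma sl2_zero: "(0 :: 'k::comm_ring_1 mat22) \<in> sl2 p"
  by (auto simp: sl2_def intro!: exI[of _ 0])

lemma sl2_subset_sq2: "(sl2 p :: 'k::comm_ring_1 mat22 set) \<subseteq> sq2 p"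
  by (auto simp: sl2_def sq2_def intro: sq_hom.gl2 sq_hom.zero)

lemma total_sl2_subset: "(total sl2 :: 'k::comm_ring_1 mat22 set) \<subseteq> total sq2"
  by (auto simp: total_sl2_eq total_sq2_eq)

section \<open>The projection onto \<open>sl2\<close>\<close>

definition even_block :: "'k mat22 \<Rightarrow> 'k mat2" where
  "even_block X = (\<chi> i j. X $ Inl i $ Inl j)"

text \<open>The projection onto \<open>sl2\<close> along the odd part and the centre of the even part.\<close>

definition sl_part :: "'k::field_char_0 mat22 \<Rightarrow> 'k mat22" where
  "sl_part X = qM (even_block X - mat (trace (even_block X) / 2)) 0"

lemma even_block_qM [simp]: "even_block (qM A B) = A"
  by (simp add: even_block_def vec_eq_iff)

lemma even_block_add: "even_block (X + Y) = even_block X + even_block Y"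
  by (simp add: even_block_def vec_eq_iff)

lemma even_block_mscale: "even_block (mscale c X) = mscale c (even_block X)"
  by (simp add: even_block_def vec_eq_iff)

lemma trace_mat: "trace (mat c :: 'k::comm_ring_1 mat2) = 2 * c"
  by (simp add: trace_2 mat_def)

lemma mat_0 [simp]: "mat 0 = 0"
  by (simp add: mat_def vec_eq_iff)

lemma mat_add: "mat (a + b) = (mat a + mat b :: 'k::monoid_add ^ 'n ^ 'n)"
  by (simp add: mat_def vec_eq_iff)

lemma mscale_mat: "mscale c (mat a) = (mat (c * a) :: 'k::ring_1 ^ 'n ^ 'n)"
  by (simp add: mat_def vec_eq_iff)

lemma mscale_diff: "mscale c (A - B) = mscale c A - mscale c (B :: 'k::ring_1 ^ 'n ^ 'm)"
  by (simp add: vec_eq_iff right_diff_distrib)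

lemma sl_part_in_sl2: "sl_part X \<in> sl2 0"
  by (auto simp: sl_part_def sl2_def trace_sub trace_mat)

lemma sl_part_in_total: "sl_part X \<in> total sl2"
  by (auto simp: sl_part_def total_sl2_eq trace_sub trace_mat)

lemma sl_part_odd: "sl_part (qM 0 B) = 0"
  by (simp add: sl_part_def)

lemma sl_part_id: "X \<in> total sl2 \<Longrightarrow> sl_part X = X"
  by (auto simp: total_sl2_eq sl_part_def)

lemma sl_part_H_sum: "sl_part (H 1 + H 2) = 0"
  by (simp add: H_sum sl_part_def trace_mat)

lemma sl_part_add: "sl_part (X + Y) = sl_part X + sl_part Y"
  by (simp add: sl_part_def even_block_add trace_add add_divide_distrib mat_add qM_add)

lemma sl_part_mscale: "sl_part (mscale c X) = mscale c (sl_part X)"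
  by (simp add: sl_part_def even_block_mscale trace_mscale mscale_qM mscale_diff mscale_mat)

text \<open>Scalar matrices are central, so removing them leaves the commutator unchanged. Hence
  \<open>sl_part\<close> respects the bracket of the even part.\<close>

lemma commutator_diff_mat:
  "(A - mat a) ** (B - mat b) - (B - mat b) ** (A - mat a) = A ** B - B ** (A :: 'k::comm_ring_1 mat2)"
  by (simp add: vec_eq_iff forall_2 mat_mult_nth_2) (simp add: mat_def algebra_simps)

lemma sl_part_sbracket_even:
  "sl_part (sbracket 0 0 (qM A 0) (qM A' 0)) = sbracket 0 0 (sl_part (qM A 0)) (sl_part (qM A' 0))"
  by (simp add: sbracket_even_even sl_part_def trace_commutator commutator_diff_mat)

text \<open>The three summands lie in \<open>sl2\<close>, in the centre and in the odd part. On a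
  simple atypical supermodule only the first one will act nontrivially.\<close>

lemma qM_decomp:
  "qM A B = sl_part (qM A B) + (mscale (trace A / 2) (H 1 + H 2) + qM 0 B)"
  by (simp add: sl_part_def H_sum mscale_qM qM_add mscale_mat)

section \<open>Supermodules\<close>

lemma ring_of_type_algebra_simps [simp]:
  "carrier ring_of_type_algebra = UNIV"
  "a \<oplus>\<^bsub>ring_of_type_algebra\<^esub> b = a + b"
  "a \<otimes>\<^bsub>ring_of_type_algebra\<^esub> b = a * b"
  "\<zero>\<^bsub>ring_of_type_algebra\<^esub> = 0"
  "\<one>\<^bsub>ring_of_type_algebra\<^esub> = 1"
  by (simp_all add: ring_of_type_algebra_def)

lemma set_add_iff: "x \<in> A <+>\<^bsub>M\<^esub> B \<longleftrightarrow> (\<exists>a\<in>A. \<exists>b\<in>B. x = a \<oplus>\<^bsub>M\<^esub> b)"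
  by (auto simp: set_add_def')

section \<open>Module notions unaffected by changing \<open>act\<close> or
  \<open>part\<close>\<close>

lemma abelian_group_update [simp]:
  "abelian_group (M\<lparr>act := a\<rparr>) \<longleftrightarrow> abelian_group M"
  "abelian_group (M\<lparr>part := P\<rparr>) \<longleftrightarrow> abelian_group M"
  by (simp_all add: abelian_group_def abelian_monoid_def abelian_group_axioms_def)

lemma module_update [simp]:
  "Module.module R (M\<lparr>act := a\<rparr>) \<longleftrightarrow> Module.module R M"
  "Module.module R (M\<lparr>part := P\<rparr>) \<longleftrightarrow> Module.module R M"
  by (simp_all add: Module.module_def Module.module_axioms_def)

lemma submodule_update [simp]:
  "submodule W R (M\<lparr>act := a\<rparr>) \<longleftrightarrow> submodule W R M"
  "submodule W R (M\<lparr>part := P\<rparr>) \<longleftrightarrow> submodule W R M"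
  by (simp_all add: submodule_def submodule_axioms_def)

lemma set_add_update [simp]:
  "A <+>\<^bsub>M\<lparr>act := a\<rparr>\<^esub> B = A <+>\<^bsub>M\<^esub> B"
  "A <+>\<^bsub>M\<lparr>part := P\<rparr>\<^esub> B = A <+>\<^bsub>M\<^esub> B"
  by (simp_all add: set_add_def')

lemma a_minus_update [simp]:
  "x \<ominus>\<^bsub>M\<lparr>act := a\<rparr>\<^esub> y = x \<ominus>\<^bsub>M\<^esub> y"
  "x \<ominus>\<^bsub>M\<lparr>part := P\<rparr>\<^esub> y = x \<ominus>\<^bsub>M\<^esub> y"
  by (simp_all add: a_minus_def a_inv_def)

lemma graded_submodule_update [simp]:
  "graded_submodule W (M\<lparr>act := a\<rparr>) \<longleftrightarrow> graded_submodule W M"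
  by (simp add: graded_submodule_def)

section \<open>Homogeneous components and closure under the action\<close>

context supermodule
begin

lemma smult_zero [simp]: "v \<in> carrier M \<Longrightarrow> 0 \<odot> v = \<zero>"
  using smult_l_null[of v] by simp

lemma part_subset: "part M p \<subseteq> carrier M"
  using submoduleE(1)[OF part_submodule] .

lemma part_closed: "v \<in> part M p \<Longrightarrow> v \<in> carrier M"
  using part_subset by blast

lemma zero_in_part [simp]: "\<zero> \<in> part M p"
  using part_inter by (cases p) auto

lemma part_add: "v \<in> part M p \<Longrightarrow> w \<in> part M p \<Longrightarrow> v \<oplus> w \<in> part M p"
  using submoduleE(5)[OF part_submodule] .

lemma decomp_carrier:
  assumes "v \<in> carrier M"
  obtains a b where "a \<in> part M p" "b \<in> part M (p + 1)" "v = a \<oplus> b"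
proof -
  obtain a b where ab: "a \<in> part M 0" "b \<in> part M 1" "v = a \<oplus> b"
    using assms part_sum set_add_iff by metis
  show ?thesis
  proof (cases "p = 0")
    case True
    then show ?thesis using ab that by simp
  next
    case False
    then show ?thesis
      using ab that[of b a] by (simp add: part_closed M.a_comm)
  qed
qed

lemma part_add_eq_zero:
  assumes "a \<in> part M p" "b \<in> part M (p + 1)" "a \<oplus> b = \<zero>"
  shows "a = \<zero>" "b = \<zero>"
proof -
  have ab: "a \<in> carrier M" "b \<in> carrier M"
    using assms part_closed by auto
  have "a = \<ominus> b"
    using assms(3) ab by (simp add: M.minus_equality)
  then have "a \<in> part M (p + 1)"
    using submoduleE(3)[OF part_submodule assms(2)] by simp
  then show "a = \<zero>"
    using assms(1) part_inter by (cases p) auto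
  then show "b = \<zero>"
    using assms(3) ab by simp
qed

text \<open>Uniqueness of the homogeneous decomposition, in the form needed to see that the inverse
  of a bijective homomorphism preserves parity.\<close>

lemma part_add_in_part:
  assumes "a \<in> part M p" "b \<in> part M (p + 1)" "a \<oplus> b \<in> part M p"
  shows "b = \<zero>"
proof -
  have ab: "a \<in> carrier M" "b \<in> carrier M"
    using assms part_closed by auto
  have "(a \<oplus> b) \<oplus> \<ominus> a \<in> part M p"
    using assms part_add submoduleE(3)[OF part_submodule] by blast
  moreover have "(a \<oplus> b) \<oplus> \<ominus> a = b"
    using ab by (simp add: M.a_comm[of a b] M.a_assoc M.r_neg)
  ultimately show ?thesis
    using assms(2) part_inter by (cases p) auto
qed

lemma part_carrier_or_zero:
  "part M (p + 1) = {\<zero>} \<Longrightarrow> part M p = carrier M"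
  using part_subset[of p] part_closed[of _ p] by (auto elim!: decomp_carrier[of _ p])

lemma smult_minus_one: "v \<in> carrier M \<Longrightarrow> (- 1) \<odot> v = \<ominus> v"
  using smult_l_distr[of "- 1" 1 v] smult_one[of v] smult_l_null[of v]
  by (simp add: M.minus_equality)

lemma set_add_comm:
  assumes "A \<subseteq> carrier M" "B \<subseteq> carrier M"
  shows "A <+>\<^bsub>M\<^esub> B = B <+>\<^bsub>M\<^esub> A"
proof -
  have "A <+>\<^bsub>M\<^esub> B \<subseteq> B <+>\<^bsub>M\<^esub> A" if "A \<subseteq> carrier M" "B \<subseteq> carrier M" for A B
  proof
    fix v
    assume "v \<in> A <+>\<^bsub>M\<^esub> B"
    then obtain a b where "a \<in> A" "b \<in> B" "v = a \<oplus> b"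
      unfolding set_add_iff by blast
    then show "v \<in> B <+>\<^bsub>M\<^esub> A"
      unfolding set_add_iff using that by (intro bexI[of _ b] bexI[of _ a]) (auto intro: M.a_comm)
  qed
  then show ?thesis
    using assms by blast
qed

lemma a_inv_zero [simp]: "\<ominus> \<zero> = \<zero>"
  by (simp add: M.minus_equality)

end

text \<open>The axioms of \<open>supermodule\<close> do not force \<open>L p \<subseteq> total L\<close>; this needs \<open>0 \<in> L p\<close>.\<close>

locale supermodule_pointed = supermodule +
  assumes L_zero: "0 \<in> L p"
begin

lemma L_total: "X \<in> L p \<Longrightarrow> X \<in> total L"
  using subset_total[of L p] L_zero by blast

text \<open>Closure is built into the axioms only for homogeneous vectors, through
  \<open>act_part\<close>; a general vector is split into its two components.\<close>

lemma act_hom_closed: "X \<in> L p \<Longrightarrow> v \<in> carrier M \<Longrightarrow> act M X v \<in> carrier M"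
proof -
  assume X: "X \<in> L p" and v: "v \<in> carrier M"
  obtain a b where ab: "a \<in> part M 0" "b \<in> part M (0 + 1)" "v = a \<oplus> b"
    using decomp_carrier[OF v] .
  have "act M X v = act M X a \<oplus> act M X b"
    using ab X L_total part_closed act_add by simp
  then show ?thesis
    using act_part[OF X ab(1)] act_part[OF X ab(2)] part_closed by auto
qed

lemma act_closed [simp]: "X \<in> total L \<Longrightarrow> v \<in> carrier M \<Longrightarrow> act M X v \<in> carrier M"
proof -
  assume "X \<in> total L" and v: "v \<in> carrier M"
  then obtain X0 X1 where X: "X0 \<in> L 0" "X1 \<in> L 1" "X = X0 + X1"
    by (auto simp: total_def)
  have "act M X v = act M X0 v \<oplus> act M X1 v"
    using X v L_total add_act by blast
  then show ?thesis
    using X v act_hom_closed by auto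
qed

lemma act_zero [simp]: "X \<in> total L \<Longrightarrow> act M X \<zero> = \<zero>"
  using act_smult[of X \<zero> 0] by simp

lemma zero_act [simp]: "v \<in> carrier M \<Longrightarrow> act M 0 v = \<zero>"
  using scale_act[of 0 v 0] L_total[OF L_zero] by simp

lemma act_sbracket_odd_odd:
  assumes "X \<in> L 1" "Y \<in> L 1" "v \<in> carrier M"
  shows "act M (sbracket 1 1 X Y) v = act M X (act M Y v) \<oplus> act M Y (act M X v)"
proof -
  have "act M Y (act M X v) \<in> carrier M"
    using assms L_total by simp
  then show ?thesis
    using act_sbracket[OF assms]
    by (simp add: parity_sign_def smult_minus_one a_minus_def)
qed

lemma act_sbracket_even:
  assumes "X \<in> L p" "Y \<in> L q" "v \<in> carrier M" "p = 0 \<or> q = 0"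
  shows "act M (sbracket p q X Y) v = act M X (act M Y v) \<ominus> act M Y (act M X v)"
proof -
  have "act M Y (act M X v) \<in> carrier M"
    using assms L_total by simp
  moreover have "parity_sign p q = (1 :: 'a)"
    using assms(4) by (auto simp: parity_sign_def)
  ultimately show ?thesis
    using act_sbracket[OF assms(1-3)] smult_one by simp
qed

end

lemma supermodule_pointed_sq2: "supermodule sq2 M \<Longrightarrow> supermodule_pointed sq2 M"
  by (simp add: supermodule_pointed_def supermodule_pointed_axioms_def sq2_zero)

lemma supermodule_pointed_sl2: "supermodule sl2 M \<Longrightarrow> supermodule_pointed sl2 M"
  by (simp add: supermodule_pointed_def supermodule_pointed_axioms_def sl2_zero)

section \<open>Isomorphisms and parity change\<close>

lemma supermodule_hom_zero:
  assumes "supermodule L M" "supermodule L N" "f \<in> supermodule_hom L M N"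
  shows "f \<zero>\<^bsub>M\<^esub> = \<zero>\<^bsub>N\<^esub>"
proof -
  interpret M: supermodule L M by fact
  interpret N: supermodule L N by fact
  have "f (0 \<odot>\<^bsub>M\<^esub> v) = 0 \<odot>\<^bsub>N\<^esub> f v" "f v \<in> carrier N" if "v \<in> carrier M" for v
    using assms(3) that by (auto simp del: M.smult_zero simp: supermodule_hom_def hom_def)
  note this[OF M.M.zero_closed]
  then show ?thesis
    using N.smult_zero[of "f \<zero>\<^bsub>M\<^esub>"] M.smult_zero[of "\<zero>\<^bsub>M\<^esub>"] by simp
qed

lemma supermodule_isomorphic_refl: "supermodule_isomorphic L M M"
  unfolding supermodule_isomorphic_def
  by (rule bexI[of _ "\<lambda>v. v"]) (auto simp: supermodule_hom_def hom_def bij_betw_def)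

lemma supermodule_isomorphic_trans:
  assumes "supermodule_isomorphic L M N" "supermodule_isomorphic L N K"
  shows "supermodule_isomorphic L M K"
proof -
  obtain f g where f: "f \<in> supermodule_hom L M N" "bij_betw f (carrier M) (carrier N)"
    and g: "g \<in> supermodule_hom L N K" "bij_betw g (carrier N) (carrier K)"
    using assms by (auto simp: supermodule_isomorphic_def)
  have "g \<circ> f \<in> supermodule_hom L M K"
    using f(1) g(1) by (auto simp: supermodule_hom_def hom_def Pi_iff image_subset_iff)
  then show ?thesis
    using bij_betw_trans[OF f(2) g(2)] by (auto simp: supermodule_isomorphic_def)
qed

text \<open>Linearity and equivariance of the inverse are formal. Parity needs an argument, since a
  homomorphism is only required to map \<open>part M p\<close> into \<open>part N p\<close>, not
  onto it.\<close>

lemma supermodule_isomorphic_sym: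
  assumes "supermodule_pointed L M" "supermodule_pointed L N" "supermodule_isomorphic L M N"
  shows "supermodule_isomorphic L N M"
proof -
  interpret M: supermodule_pointed L M by fact
  interpret N: supermodule_pointed L N by fact
  obtain f where f: "f \<in> supermodule_hom L M N" and bij: "bij_betw f (carrier M) (carrier N)"
    using assms(3) by (auto simp: supermodule_isomorphic_def)
  have f_add: "f (v \<oplus>\<^bsub>M\<^esub> w) = f v \<oplus>\<^bsub>N\<^esub> f w" if "v \<in> carrier M" "w \<in> carrier M" for v w
    using f that by (auto simp: supermodule_hom_def hom_def)
  have f_smult: "f (c \<odot>\<^bsub>M\<^esub> v) = c \<odot>\<^bsub>N\<^esub> f v" if "v \<in> carrier M" for c v
    using f that by (auto simp: supermodule_hom_def)
  have f_part: "f v \<in> part N p" if "v \<in> part M p" for v p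
    using f that unfolding supermodule_hom_def by blast
  have f_act: "f (act M X v) = act N X (f v)" if "X \<in> total L" "v \<in> carrier M" for X v
    using f that by (auto simp: supermodule_hom_def)
  define g where "g = the_inv_into (carrier M) f"
  have inj: "inj_on f (carrier M)" and surj: "f ` carrier M = carrier N"
    using bij by (auto simp: bij_betw_def)
  have g_f: "g (f v) = v" if "v \<in> carrier M" for v
    using the_inv_into_f_f[OF inj that] by (simp add: g_def)
  have ex: "\<exists>v\<in>carrier M. w = f v" if "w \<in> carrier N" for w
    using surj that by blast
  have "g \<in> supermodule_hom L N M"
    unfolding supermodule_hom_def
  proof (intro CollectI conjI allI ballI)
    show "g \<in> hom (add_monoid N) (add_monoid M)"
    proof (rule homI)
      fix x y
      assume xy: "x \<in> carrier (add_monoid N)" "y \<in> carrier (add_monoid N)"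
      then obtain v w where "v \<in> carrier M" "x = f v" "w \<in> carrier M" "y = f w"
        using ex by auto metis
      then show "g (x \<otimes>\<^bsub>add_monoid N\<^esub> y) = g x \<otimes>\<^bsub>add_monoid M\<^esub> g y"
        by (simp add: g_f flip: f_add)
    next
      fix x
      assume "x \<in> carrier (add_monoid N)"
      then obtain v where "v \<in> carrier M" "x = f v"
        using ex by auto
      then show "g x \<in> carrier (add_monoid M)"
        by (simp add: g_f)
    qed
  next
    fix c w
    assume "w \<in> carrier N"
    then obtain v where "v \<in> carrier M" "w = f v"
      using ex by blast
    then show "g (c \<odot>\<^bsub>N\<^esub> w) = c \<odot>\<^bsub>M\<^esub> g w"
      by (simp add: g_f flip: f_smult)
  next
    fix X w
    assume "X \<in> total L" "w \<in> carrier N"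
    then obtain v where "v \<in> carrier M" "w = f v" "X \<in> total L"
      using ex by blast
    then show "g (act N X w) = act M X (g w)"
      by (simp add: g_f flip: f_act)
  next
    fix p
    show "g ` part N p \<subseteq> part M p"
    proof
      fix v
      assume "v \<in> g ` part N p"
      then obtain w where w: "w \<in> part N p" "v = g w"
        by blast
      then obtain u where u: "u \<in> carrier M" "w = f u"
        using ex N.part_closed by blast
      obtain a b where ab: "a \<in> part M p" "b \<in> part M (p + 1)" "u = a \<oplus>\<^bsub>M\<^esub> b"
        using M.decomp_carrier[OF u(1)] .
      have abc: "a \<in> carrier M" "b \<in> carrier M"
        using ab M.part_closed by auto
      \<comment> \<open>The vector \<open>w\<close> is the sum of \<open>f a\<close> and
        \<open>f b\<close> and lies in \<open>part N p\<close>, so its component \<open>f b\<close>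
        of the other parity vanishes; injectivity then kills \<open>b\<close>.\<close>
      have "f b = \<zero>\<^bsub>N\<^esub>"
        using N.part_add_in_part[OF f_part[OF ab(1)] f_part[OF ab(2)]] w(1) u(2) ab(3) f_add[OF abc]
        by simp
      then have "f b = f \<zero>\<^bsub>M\<^esub>"
        using supermodule_hom_zero[OF M.supermodule_axioms N.supermodule_axioms f] by simp
      then have "b = \<zero>\<^bsub>M\<^esub>"
        using inj_onD[OF inj _ abc(2)] by simp
      then show "v \<in> part M p"
        using ab abc w(2) u g_f by simp
    qed
  qed
  moreover have "bij_betw g (carrier N) (carrier M)"
    unfolding g_def using bij by (rule bij_betw_the_inv_into)
  ultimately show ?thesis
    by (auto simp: supermodule_isomorphic_def)
qed

section \<open>Parity change\<close>

lemma part_parity_change [simp]: "part (parity_change M) p = part M (p + 1)"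
  by (simp add: parity_change_def)

lemma act_parity_change [simp]: "act (parity_change M) = act M"
  by (simp add: parity_change_def)

lemma parity_change_simps [simp]:
  "carrier (parity_change M) = carrier M"
  "add (parity_change M) = add M"
  "zero (parity_change M) = zero M"
  "smult (parity_change M) = smult M"
  by (simp_all add: parity_change_def)

lemma bit_add_one_one: "(p :: bit) + 1 + 1 = p"
  by (cases p) simp_all

text \<open>An equality of records and not merely an isomorphism, because
  \<open>p + 1 + 1 = p\<close> in \<open>bit\<close>. Double parity changes can therefore be removed
  by rewriting.\<close>

lemma parity_change_parity_change: "parity_change (parity_change M) = (M :: ('k, 'v) smod)"
proof -
  have "parity_change (parity_change M) = M\<lparr>part := \<lambda>p. part M (p + 1 + 1)\<rparr>"
    by (simp add: parity_change_def)
  also have "\<dots> = M"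
    by (simp only: bit_add_one_one) simp
  finally show ?thesis .
qed

lemma supermodule_parity_change:
  assumes "supermodule L M"
  shows "supermodule L (parity_change M)"
proof -
  interpret M: supermodule L M by fact
  show ?thesis
  proof (intro supermodule.intro supermodule_axioms.intro)
    show "Module.module ring_of_type_algebra (parity_change M)"
      using M.module_axioms by (simp add: parity_change_def)
    show "submodule (part (parity_change M) p) ring_of_type_algebra (parity_change M)" for p
      using M.part_submodule by (simp add: parity_change_def)
    have "part M 1 <+>\<^bsub>M\<^esub> part M 0 = part M 0 <+>\<^bsub>M\<^esub> part M 1"
      by (intro M.set_add_comm M.part_subset)
    then show "part (parity_change M) 0 <+>\<^bsub>parity_change M\<^esub> part (parity_change M) 1
        = carrier (parity_change M)"
      using M.part_sum by (simp add: parity_change_def)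
    show "part (parity_change M) 0 \<inter> part (parity_change M) 1 = {\<zero>\<^bsub>parity_change M\<^esub>}"
      using M.part_inter by (simp add: Int_commute)
    fix X p v q
    show "X \<in> L p \<Longrightarrow> v \<in> part (parity_change M) q \<Longrightarrow>
        act (parity_change M) X v \<in> part (parity_change M) (p + q)"
      using M.act_part[of X p v "q + 1"] by (simp add: add.assoc)
  next
    fix X Y p q v
    assume "X \<in> L p" "Y \<in> L q" "v \<in> carrier (parity_change M)"
    then show "act (parity_change M) (sbracket p q X Y) v =
        act (parity_change M) X (act (parity_change M) Y v) \<ominus>\<^bsub>parity_change M\<^esub>
        parity_sign p q \<odot>\<^bsub>parity_change M\<^esub> act (parity_change M) Y (act (parity_change M) X v)"
      using M.act_sbracket by (simp add: parity_change_def)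
  qed (simp_all add: M.act_add M.act_smult M.add_act M.scale_act)
qed

lemma subsupermodule_parity_change:
  assumes "supermodule L M" "subsupermodule L W (parity_change M)"
  shows "subsupermodule L W M"
proof -
  interpret M: supermodule L M by fact
  have "(W \<inter> part M 1) <+>\<^bsub>M\<^esub> (W \<inter> part M 0) = (W \<inter> part M 0) <+>\<^bsub>M\<^esub> (W \<inter> part M 1)"
    by (intro M.set_add_comm) (auto dest: M.part_closed)
  then show ?thesis
    using assms(2) by (simp add: subsupermodule_def graded_submodule_def parity_change_def)
qed

lemma simple_supermodule_parity_change:
  assumes "simple_supermodule L M"
  shows "simple_supermodule L (parity_change M)"
proof -
  have "supermodule L M"
    using assms by (simp add: simple_supermodule_def)
  then show ?thesis
    using assms supermodule_parity_change[of L M] subsupermodule_parity_change[of L M]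
    unfolding simple_supermodule_def by simp
qed

lemma simple_atypical_parity_change:
  "M \<in> simple_atypical \<Longrightarrow> parity_change M \<in> simple_atypical"
  by (simp add: simple_atypical_def atypical_def simple_supermodule_parity_change)

lemma supermodule_hom_parity_change:
  assumes "f \<in> supermodule_hom L M N"
  shows "f \<in> supermodule_hom L (parity_change M) (parity_change N)"
  using assms by (simp add: supermodule_hom_def hom_def)

lemma supermodule_isomorphic_parity_change:
  "supermodule_isomorphic L M N \<Longrightarrow> supermodule_isomorphic L (parity_change M) (parity_change N)"
  unfolding supermodule_isomorphic_def
  by (auto intro!: bexI[OF _ supermodule_hom_parity_change])

text \<open>The axioms are inherited from \<open>M\<close>, but \<open>Res\<close> leaves the action
  undefined outside \<open>total sl2\<close>. Each axiom thus requires that the elements in it,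
  including sums, scalar multiples and superbrackets, stay in \<open>total sl2\<close>.\<close>

lemma supermodule_Res_sl2:
  assumes "supermodule sq2 M"
  shows "supermodule sl2 (Res sl2 M)"
proof -
  interpret M: supermodule_pointed sq2 M
    using assms by (rule supermodule_pointed_sq2)
  note sub = subsetD[OF total_sl2_subset] subsetD[OF sl2_subset_sq2]
  have total: "X \<in> total sl2" if "X \<in> sl2 p" for X :: "'a mat22" and p
    using that subset_total[of sl2] sl2_zero by blast
  have closed: "X + Y \<in> total sl2" "mscale c X \<in> total sl2"
    if "X \<in> total sl2" "Y \<in> total sl2" for X Y :: "'a mat22" and c
    using that by (auto simp: total_sl2_eq qM_add mscale_qM trace_add trace_mscale)
  have bracket: "sbracket p q X Y \<in> total sl2" if "X \<in> sl2 p" "Y \<in> sl2 q" for X Y :: "'a mat22" and p q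
  proof (cases "p = 0 \<and> q = 0")
    case True
    then show ?thesis
      using that by (auto simp: sl2_def total_sl2_eq sbracket_even_even trace_commutator)
  next
    case False
    \<comment> \<open>One of the two parities is odd, and the odd component of \<open>sl2\<close> is
      zero.\<close>
    then have "X = 0 \<or> Y = 0"
      using that by (auto simp: sl2_def split: if_splits)
    then have "sbracket p q X Y = 0"
      by (auto simp: sbracket_def)
    then show ?thesis
      using total[OF sl2_zero] by simp
  qed
  show ?thesis
  proof (intro supermodule.intro supermodule_axioms.intro)
    fix X Y :: "'a mat22" and p q v
    assume *: "X \<in> sl2 p" "Y \<in> sl2 q" "v \<in> carrier (Res sl2 M)"
    then show "act (Res sl2 M) (sbracket p q X Y) v =
        act (Res sl2 M) X (act (Res sl2 M) Y v) \<ominus>\<^bsub>Res sl2 M\<^esub>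
        parity_sign p q \<odot>\<^bsub>Res sl2 M\<^esub> act (Res sl2 M) Y (act (Res sl2 M) X v)"
      using M.act_sbracket[of X p Y q v] by (simp add: Res_def total bracket sub)
  next
    fix X :: "'a mat22" and p q v
    assume "X \<in> sl2 p" "v \<in> part (Res sl2 M) q"
    then show "act (Res sl2 M) X v \<in> part (Res sl2 M) (p + q)"
      using M.act_part[of X p v q] by (simp add: Res_def total sub)
  qed (use M.module_axioms M.part_submodule M.part_sum M.part_inter in
      \<open>simp_all add: Res_def closed sub M.act_add M.act_smult M.add_act M.scale_act\<close>)
qed

section \<open>Simple atypical supermodules\<close>

context
  fixes M :: "('k::field_char_0, 'v) smod" (structure)
  assumes simple: "simple_supermodule sq2 M" and atyp: "atypical M"
begin

interpretation supermodule_pointed sq2 M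
  using simple by (intro supermodule_pointed_sq2) (simp add: simple_supermodule_def)

section \<open>Vanishing of the odd action\<close>

lemma H_sum_total: "mscale c (H 1 + H 2) \<in> (total sq2 :: 'k mat22 set)"
  by (auto simp: H_sum total_sq2_eq mscale_qM)

lemma act_central: "v \<in> carrier M \<Longrightarrow> act M (mscale c (H 1 + H 2)) v = \<zero>"
  using atyp H_sum_total[of 1] by (simp add: scale_act atypical_def)

text \<open>The superbracket of two odd elements is a multiple of \<open>H 1 + H 2\<close>, which
  acts by zero by atypicality.\<close>

lemma odd_anticommute:
  assumes "X \<in> sq2 1" "Y \<in> sq2 1" "v \<in> carrier M"
  shows "act M X (act M Y v) = \<ominus> act M Y (act M X v)"
proof -
  have "act M (sbracket 1 1 X Y) v = \<zero>"
    using assms by (auto simp: sq2_1_eq sbracket_odd_odd act_central)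
  then show ?thesis
    using act_sbracket_odd_odd[OF assms] assms L_total by (simp add: M.minus_equality)
qed

text \<open>Anticommutation of \<open>X\<close> with itself shows that twice the vector is zero;
  characteristic zero allows division by 2.\<close>

lemma odd_square_zero:
  assumes "X \<in> sq2 1" "v \<in> carrier M"
  shows "act M X (act M X v) = \<zero>"
proof -
  let ?w = "act M X (act M X v)"
  have w: "?w \<in> carrier M"
    using assms L_total by simp
  have "?w \<oplus> ?w = \<zero>"
    using odd_anticommute[OF assms(1,1,2)] w M.r_neg by metis
  then have "(1 + 1) \<odot> ?w = \<zero>"
    using w smult_l_distr[of 1 1 ?w] smult_one[OF w] by simp
  then have "(1 / 2) \<odot> ((1 + 1) \<odot> ?w) = \<zero>"
    using smult_r_null[of "1 / 2"] by simp
  then show ?thesis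
    using w smult_assoc1[of "1 / 2" "1 + 1" ?w] smult_one[OF w] by simp
qed

text \<open>If \<open>X\<close> does not kill \<open>v\<close>, replace \<open>v\<close> by
  \<open>act M X v\<close>: it is killed by \<open>X\<close> because \<open>X\<close> squares to
  zero, and by anticommutation every odd \<open>Y\<close> that killed \<open>v\<close> still kills
  it.\<close>

lemma odd_kill_one_more:
  assumes "v \<in> carrier M" "v \<noteq> \<zero>" "X \<in> sq2 1"
  obtains w where "w \<in> carrier M" "w \<noteq> \<zero>" "act M X w = \<zero>"
    "\<And>Y. Y \<in> sq2 1 \<Longrightarrow> act M Y v = \<zero> \<Longrightarrow> act M Y w = \<zero>"
proof (cases "act M X v = \<zero>")
  case True
  then show ?thesis using assms that by blast
next
  case False
  have X: "X \<in> total sq2"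
    using assms L_total by blast
  have "act M Y (act M X v) = \<zero>" if "Y \<in> sq2 1" "act M Y v = \<zero>" for Y
    using odd_anticommute[OF that(1) assms(3,1)] that X by simp
  then show ?thesis
    using that[of "act M X v"] False odd_square_zero assms X by simp
qed

text \<open>Three applications of \<open>odd_kill_one_more\<close>, one for each odd generator,
  produce a nonzero vector killed by all of them; \<open>odd_basis\<close> extends this to the whole
  odd part.\<close>

lemma odd_common_kernel:
  obtains w where "w \<in> carrier M" "w \<noteq> \<zero>" "\<And>X. X \<in> sq2 1 \<Longrightarrow> act M X w = \<zero>"
proof -
  have gens: "(Ebar :: 'k mat22) \<in> sq2 1" "(Fbar :: 'k mat22) \<in> sq2 1"
    "(Hbar 1 - Hbar 2 :: 'k mat22) \<in> sq2 1"
    by (simp_all add: sq2_def sq_hom.Ebar sq_hom.Fbar sq_hom.Hbar)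
  have "\<exists>v\<in>carrier M. v \<noteq> \<zero>"
    using simple M.zero_closed unfolding simple_supermodule_def by blast
  then obtain v where v: "v \<in> carrier M" "v \<noteq> \<zero>"
    by blast
  obtain v1 where v1: "v1 \<in> carrier M" "v1 \<noteq> \<zero>" "act M Ebar v1 = \<zero>"
    using odd_kill_one_more[OF v gens(1)] by metis
  obtain v2 where v2: "v2 \<in> carrier M" "v2 \<noteq> \<zero>" "act M Fbar v2 = \<zero>" "act M Ebar v2 = \<zero>"
    using odd_kill_one_more[OF v1(1,2) gens(2)] gens v1(3) by metis
  obtain w where w: "w \<in> carrier M" "w \<noteq> \<zero>" "act M (Hbar 1 - Hbar 2) w = \<zero>"
      "act M Fbar w = \<zero>" "act M Ebar w = \<zero>"
    using odd_kill_one_more[OF v2(1,2) gens(3)] gens v2(3,4) by metis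
  have "act M X w = \<zero>" if X: "X \<in> sq2 1" for X
  proof -
    obtain B where B: "X = qM 0 B" "trace B = 0"
      using X by (auto simp: sq2_1_eq)
    have scaled: "mscale c Y \<in> sq2 1" if "Y \<in> sq2 1" for c and Y :: "'k mat22"
      using that by (simp add: sq2_def sq_hom.scale)
    have sum: "Y + Z \<in> sq2 1" if "Y \<in> sq2 1" "Z \<in> sq2 1" for Y Z :: "'k mat22"
      using that by (simp add: sq2_def sq_hom.add)
    have act_scaled: "act M (mscale c Y) w = \<zero>" if "Y \<in> sq2 1" "act M Y w = \<zero>" for c Y
      using that w(1) scale_act[OF L_total[OF that(1)]] by (simp add: smult_r_null)
    have act_sum: "act M (Y + Z) w = \<zero>"
      if "Y \<in> sq2 1" "Z \<in> sq2 1" "act M Y w = \<zero>" "act M Z w = \<zero>" for Y Z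
      using that w(1) add_act[OF L_total[OF that(1)] L_total[OF that(2)]] by simp
    show ?thesis
      unfolding B(1) odd_basis[OF B(2)] by (intro act_sum act_scaled sum scaled gens w)
  qed
  then show ?thesis
    using that w by blast
qed

text \<open>The common kernel \<open>W\<close> of the odd part is a nonzero subsupermodule, hence
  everything by simplicity. It is graded because odd elements send the two components of a vector to
  opposite parities, and stable because the bracket of an odd with an even element is odd.\<close>

lemma odd_act_zero:
  assumes "X \<in> sq2 1" "v \<in> carrier M"
  shows "act M X v = \<zero>"
proof -
  define W where "W = {v \<in> carrier M. \<forall>X\<in>sq2 1. act M X v = \<zero>}"
  have tot: "X \<in> total sq2" if "X \<in> sq2 1" for X :: "'k mat22"
    using that L_total by blast
  have "subsupermodule sq2 W M"
    unfolding subsupermodule_def graded_submodule_def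
  proof (intro conjI ballI)
    show sub: "submodule W ring_of_type_algebra M"
    proof (rule submoduleI)
      fix a
      assume "a \<in> W"
      then have "(- 1) \<odot> a \<in> W"
        by (simp add: W_def act_smult tot smult_r_null)
      then show "\<ominus> a \<in> W"
        using \<open>a \<in> W\<close> by (simp add: W_def smult_minus_one)
    qed (auto simp: W_def act_add act_smult tot smult_r_null)
    show "W = (W \<inter> part M 0) <+>\<^bsub>M\<^esub> (W \<inter> part M 1)"
    proof (intro equalityI subsetI)
      fix v
      assume v: "v \<in> W"
      then have "v \<in> carrier M"
        by (simp add: W_def)
      then obtain a b where ab: "a \<in> part M 0" "b \<in> part M (0 + 1)" "v = a \<oplus> b"
        using decomp_carrier by metis
      have abc: "a \<in> carrier M" "b \<in> carrier M"
        using ab part_closed by auto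
      have "act M X a = \<zero> \<and> act M X b = \<zero>" if X: "X \<in> sq2 1" for X
      proof -
        \<comment> \<open>The parities are written \<open>1\<close> and \<open>1 + 1\<close> to fit
          \<open>part_add_eq_zero\<close> with \<open>p = 1\<close>: two vectors of opposite
          parities with sum zero both vanish.\<close>
        have "act M X a \<in> part M 1" "act M X b \<in> part M (1 + 1)"
          using act_part[OF X ab(1)] act_part[OF X ab(2)] by simp_all
        moreover have "act M X a \<oplus> act M X b = \<zero>"
          using v X ab abc by (simp add: W_def act_add tot)
        ultimately show ?thesis
          using part_add_eq_zero by blast
      qed
      then have "a \<in> W" "b \<in> W"
        using abc by (simp_all add: W_def)
      then show "v \<in> (W \<inter> part M 0) <+>\<^bsub>M\<^esub> (W \<inter> part M 1)"
        using ab by (auto simp: set_add_iff)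
    next
      fix v
      assume "v \<in> (W \<inter> part M 0) <+>\<^bsub>M\<^esub> (W \<inter> part M 1)"
      then show "v \<in> W"
        using submoduleE(5)[OF sub] by (auto simp: set_add_iff)
    qed
    fix X :: "'k mat22" and w
    assume "X \<in> total sq2" and w: "w \<in> W"
    then obtain X0 X1 where X: "X0 \<in> sq2 0" "X1 \<in> sq2 1" "X = X0 + X1"
      by (auto simp: total_def)
    have wc: "w \<in> carrier M" and w0: "\<And>Y. Y \<in> sq2 1 \<Longrightarrow> act M Y w = \<zero>"
      using w by (auto simp: W_def)
    have X0: "X0 \<in> total sq2"
      using X L_total by blast
    have eq: "act M X w = act M X0 w"
      using X X0 wc w0 tot by (simp add: add_act)
    \<comment> \<open>Moving \<open>Y\<close> past \<open>X0\<close> costs the bracket of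
      \<open>Y\<close> and \<open>X0\<close>, which is odd and so kills \<open>w\<close>, just as
      \<open>Y\<close> does.\<close>
    have "act M Y (act M X0 w) = \<zero>" if Y: "Y \<in> sq2 1" for Y
    proof -
      have "sbracket 1 0 Y X0 \<in> sq2 1"
        using sq_hom.bracket[of 1 Y 0 X0] Y X(1) by (simp add: sq2_def)
      then have "act M Y (act M X0 w) \<ominus> act M X0 (act M Y w) = \<zero>"
        using act_sbracket_even[OF Y X(1) wc] w0 by simp
      then show ?thesis
        using w0[OF Y] X0 Y tot wc by (simp add: a_minus_def)
    qed
    then show "act M X w \<in> W"
      using eq X0 wc by (simp add: W_def)
  qed
  moreover have "W \<noteq> {\<zero>}"
  proof -
    obtain w where "w \<in> carrier M" "w \<noteq> \<zero>" "\<And>X. X \<in> sq2 1 \<Longrightarrow> act M X w = \<zero>"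
      using odd_common_kernel by blast
    then have "w \<in> W" "w \<noteq> \<zero>"
      by (simp_all add: W_def)
    then show ?thesis
      by blast
  qed
  ultimately have "W = carrier M"
    using simple unfolding simple_supermodule_def by blast
  then show ?thesis
    using assms by (auto simp: W_def)
qed

text \<open>In \<open>qM_decomp\<close> the central summand acts by zero by atypicality and the odd
  summand by \<open>odd_act_zero\<close>. The action of \<open>sq2\<close> thus factors through
  \<open>sl_part\<close>.\<close>

lemma act_sl_part:
  assumes "X \<in> total sq2" "v \<in> carrier M"
  shows "act M X v = act M (sl_part X) v"
proof -
  obtain A B where X: "X = qM A B" "trace B = 0"
    using assms(1) by (auto simp: total_sq2_eq)
  let ?c = "mscale (trace A / 2) (H 1 + H 2) :: 'k mat22"
  have B: "qM 0 B \<in> sq2 1"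
    using X(2) by (auto simp: sq2_1_eq)
  have c: "?c + qM 0 B \<in> total sq2" and s: "sl_part X \<in> total sq2"
    using X(2) sl_part_in_total total_sl2_subset by (auto simp: total_sq2_eq H_sum mscale_qM qM_add)
  have "act M X v = act M (sl_part X) v \<oplus> (act M ?c v \<oplus> act M (qM 0 B) v)"
    using qM_decomp[of A B] add_act[OF s c assms(2)] add_act[OF H_sum_total L_total[OF B] assms(2)] X(1)
    by metis
  then show ?thesis
    using s assms(2) by (simp add: act_central odd_act_zero[OF B])
qed

text \<open>Every element acts like the even element \<open>sl_part X\<close>, so the action
  preserves parity. With simplicity this concentrates \<open>M\<close> in a single parity.\<close>

lemma part_zero_subsupermodule: "subsupermodule sq2 (part M 0) M"
proof -
  have "part M 0 = part M 0 <+>\<^bsub>M\<^esub> {\<zero>}"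
    using part_closed by (auto simp: set_add_iff)
  moreover have "act M X w \<in> part M 0" if X: "X \<in> total sq2" and w: "w \<in> part M 0" for X w
  proof -
    have "sl_part X \<in> sq2 0"
      using sl_part_in_sl2 sl2_subset_sq2 by blast
    then show ?thesis
      using act_sl_part[OF X part_closed[OF w]] act_part[OF _ w] by fastforce
  qed
  ultimately show ?thesis
    using part_submodule[of 0] part_inter
    by (simp add: subsupermodule_def graded_submodule_def)
qed

lemma purely_even_or_parity_change: "purely_even M \<or> purely_even (parity_change M)"
proof -
  consider "part M 0 = {\<zero>}" | "part M 0 = carrier M"
    using simple part_zero_subsupermodule unfolding simple_supermodule_def by blast
  then show ?thesis
  proof cases
    case 2
    then have "part M 1 = {\<zero>}"
      using part_inter part_subset[of 1] by blast
    then show ?thesis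
      by (simp add: purely_even_def)
  qed (simp add: purely_even_def)
qed

text \<open>As \<open>sq2\<close> acts through \<open>sl_part\<close>, a graded subspace stable
  under \<open>sl2\<close> is stable under all of \<open>sq2\<close>.\<close>

lemma Res_sl2_simple: "simple_supermodule sl2 (Res sl2 M)"
proof -
  have "subsupermodule sq2 W M" if W: "subsupermodule sl2 W (Res sl2 M)" for W
  proof -
    have g: "graded_submodule W M"
      using W by (simp add: subsupermodule_def Res_def)
    then have sub: "W \<subseteq> carrier M"
      using submoduleE(1) by (simp add: graded_submodule_def)
    have "act M X w \<in> W" if "X \<in> total sq2" "w \<in> W" for X w
    proof -
      have "act (Res sl2 M) (sl_part X) w \<in> W"
        using W that(2) sl_part_in_total[of X] by (simp add: subsupermodule_def)
      then show ?thesis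
        using act_sl_part[OF that(1)] that(2) sub sl_part_in_total[of X] by (auto simp: Res_def)
    qed
    then show ?thesis
      using g by (simp add: subsupermodule_def)
  qed
  then show ?thesis
    using simple supermodule_Res_sl2[of M] by (auto simp: simple_supermodule_def Res_def)
qed

end

section \<open>Inflation\<close>

definition inflate :: "('k::field_char_0, 'v) smod \<Rightarrow> ('k, 'v) smod" where
  "inflate N = N\<lparr>act := \<lambda>X. act N (sl_part X)\<rparr>"

text \<open>Within \<open>sq2\<close>, the kernel of \<open>sl_part\<close> is the odd part plus the
  centre. It is an ideal because brackets of odd elements are central, so \<open>sl_part\<close> is
  a homomorphism and the action can be pulled back along it.\<close>

lemma supermodule_inflate:
  fixes N :: "('k::field_char_0, 'v) smod"
  assumes "supermodule sl2 N"
  shows "supermodule sq2 (inflate N)"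
proof -
  interpret N: supermodule_pointed sl2 N
    using assms by (rule supermodule_pointed_sl2)
  have odd: "sl_part X = 0" if "X \<in> sq2 1" for X :: "'k mat22"
    using that by (auto simp: sq2_1_eq sl_part_odd)
  show ?thesis
  proof (intro supermodule.intro supermodule_axioms.intro)
    fix X :: "'k mat22" and p q v
    assume X: "X \<in> sq2 p" and v: "v \<in> part (inflate N) q"
    then have v: "v \<in> part N q"
      by (simp add: inflate_def)
    have "act N (sl_part X) v \<in> part N (p + q)"
    proof (cases "p = 0")
      case True
      then show ?thesis
        using N.act_part[OF sl_part_in_sl2 v] by simp
    next
      case False
      then show ?thesis
        using odd X N.part_closed[OF v] by simp
    qed
    then show "act (inflate N) X v \<in> part (inflate N) (p + q)"
      by (simp add: inflate_def)
  next
    fix X Y :: "'k mat22" and p q v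
    assume X: "X \<in> sq2 p" and Y: "Y \<in> sq2 q" and "v \<in> carrier (inflate N)"
    then have v: "v \<in> carrier N"
      by (simp add: inflate_def)
    let ?x = "sl_part X" and ?y = "sl_part Y"
    have "act N (sl_part (sbracket p q X Y)) v =
        act N ?x (act N ?y v) \<ominus>\<^bsub>N\<^esub> parity_sign p q \<odot>\<^bsub>N\<^esub> act N ?y (act N ?x v)"
    proof (cases "p = 0 \<and> q = 0")
      case True
      then have "sl_part (sbracket p q X Y) = sbracket p q ?x ?y"
        using X Y by (auto simp: sq2_0_eq sl_part_sbracket_even)
      then show ?thesis
        using N.act_sbracket[OF sl_part_in_sl2 sl_part_in_sl2 v] True by simp
    next
      case False
      \<comment> \<open>At least one argument is odd, so the bracket is central or odd. The other
        side vanishes as well, since \<open>sl_part\<close> kills the odd argument.\<close>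
      have "sl_part (sbracket p q X Y) = 0"
      proof (cases "p = 1 \<and> q = 1")
        case True
        then show ?thesis
          using X Y by (auto simp: sq2_1_eq sbracket_odd_odd sl_part_mscale sl_part_H_sum)
      next
        case f: False
        then have "p + q = 1"
          using False by (cases p; cases q) auto
        then have "sbracket p q X Y \<in> sq2 1"
          using X Y sq_hom.bracket[of p X q Y] by (simp add: sq2_def)
        then show ?thesis
          by (rule odd)
      qed
      moreover have "?x = 0 \<or> ?y = 0"
        using False X Y odd by (cases p; cases q) auto
      ultimately show ?thesis
        using v sl_part_in_total[of X] sl_part_in_total[of Y] N.smult_r_null by (auto simp: a_minus_def)
    qed
    then show "act (inflate N) (sbracket p q X Y) v =
        act (inflate N) X (act (inflate N) Y v) \<ominus>\<^bsub>inflate N\<^esub>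
        parity_sign p q \<odot>\<^bsub>inflate N\<^esub> act (inflate N) Y (act (inflate N) X v)"
      by (simp add: inflate_def)
  qed (use N.module_axioms N.part_submodule N.part_sum N.part_inter in
      \<open>simp_all add: inflate_def sl_part_in_total sl_part_add sl_part_mscale N.act_add N.act_smult N.add_act N.scale_act\<close>)
qed

text \<open>Since \<open>sl_part\<close> is the identity on \<open>total sl2\<close>,
  subsupermodules of the inflation are subsupermodules of \<open>N\<close>; atypicality holds
  because \<open>sl_part\<close> kills \<open>H 1 + H 2\<close>.\<close>

lemma inflate_simple_atypical:
  assumes N: "simple_supermodule sl2 N"
  shows "inflate N \<in> simple_atypical"
proof -
  interpret N: supermodule_pointed sl2 N
    using N by (intro supermodule_pointed_sl2) (simp add: simple_supermodule_def)
  have "subsupermodule sl2 W N" if "subsupermodule sq2 W (inflate N)" for W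
  proof -
    have "act N X w \<in> W" if "X \<in> total sl2" "w \<in> W" for X w
    proof -
      have "X \<in> total sq2"
        using that total_sl2_subset by blast
      then have "act N (sl_part X) w \<in> W"
        using \<open>subsupermodule sq2 W (inflate N)\<close> \<open>w \<in> W\<close> by (simp add: subsupermodule_def inflate_def)
      then show ?thesis
        using sl_part_id[OF that(1)] by simp
    qed
    then show ?thesis
      using that by (simp add: subsupermodule_def inflate_def)
  qed
  then show ?thesis
    using N supermodule_inflate[OF N.supermodule_axioms]
    by (auto simp: simple_atypical_def simple_supermodule_def atypical_def inflate_def sl_part_H_sum)
qed

text \<open>The identity map is an isomorphism. The two records may still differ, as
  \<open>Res\<close> makes the action undefined outside \<open>total sl2\<close> while
  \<open>act N\<close> is arbitrary there.\<close>

lemma Res_inflate_isomorphic: "supermodule_isomorphic sl2 (Res sl2 (inflate N)) N"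
  unfolding supermodule_isomorphic_def
  by (rule bexI[of _ "\<lambda>v. v"])
    (auto simp: supermodule_hom_def hom_def bij_betw_def Res_def inflate_def sl_part_id)

section \<open>Classes\<close>

lemma carrier_Res [simp]: "carrier (Res L M) = carrier M"
  by (simp add: Res_def)

lemma purely_even_Res [simp]: "purely_even (Res L M) \<longleftrightarrow> purely_even M"
  by (simp add: purely_even_def Res_def)

lemma purely_even_inflate [simp]: "purely_even (inflate N) \<longleftrightarrow> purely_even N"
  by (simp add: purely_even_def inflate_def)

text \<open>Simplicity of the restriction is automatic by \<open>Res_sl2_simple\<close>, so only the
  grading decides which members of a class restrict to simple purely even modules.\<close>

lemma Res_in_simple_even_sl2:
  fixes M :: "('k::field_char_0, 'v) smod"
  shows "M \<in> simple_atypical \<Longrightarrow> Res sl2 M \<in> simple_even_sl2 \<longleftrightarrow> purely_even M"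
  by (auto simp: simple_atypical_def simple_even_sl2_def Res_sl2_simple)

lemma equiv_iso_sl2: "equiv (simple_even_sl2 :: ('k::field_char_0, 'v) smod set) iso_sl2"
proof (intro equivI)
  show "sym (iso_sl2 :: (('k, 'v) smod \<times> ('k, 'v) smod) set)"
  proof (rule symI)
    fix M N :: "('k, 'v) smod"
    assume "(M, N) \<in> iso_sl2"
    then show "(N, M) \<in> iso_sl2"
      using supermodule_isomorphic_sym[OF supermodule_pointed_sl2 supermodule_pointed_sl2, of M N]
      by (simp add: iso_sl2_def simple_even_sl2_def simple_supermodule_def)
  qed
  show "trans (iso_sl2 :: (('k, 'v) smod \<times> ('k, 'v) smod) set)"
    by (rule transI) (auto simp: iso_sl2_def intro: supermodule_isomorphic_trans)
qed (auto simp: iso_sl2_def refl_on_def supermodule_isomorphic_refl)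

text \<open>Parity change carries isomorphisms to isomorphisms and is an involution, so it can be
  moved from one side of an isomorphism to the other.\<close>

lemma equiv_iso_up_to_parity: "equiv (simple_atypical :: ('k::field_char_0, 'v) smod set) iso_up_to_parity"
proof (intro equivI)
  have sm: "supermodule_pointed sq2 M" if "M \<in> simple_atypical" for M :: "('k, 'v) smod"
    using that by (intro supermodule_pointed_sq2) (simp add: simple_atypical_def simple_supermodule_def)
  show "sym (iso_up_to_parity :: (('k, 'v) smod \<times> ('k, 'v) smod) set)"
  proof (rule symI)
    fix M N :: "('k, 'v) smod"
    assume MN: "(M, N) \<in> iso_up_to_parity"
    then have M: "M \<in> simple_atypical" and N: "N \<in> simple_atypical"
      by (auto simp: iso_up_to_parity_def)
    have "supermodule_isomorphic sq2 N (parity_change M)" if "supermodule_isomorphic sq2 M (parity_change N)"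
      using supermodule_isomorphic_parity_change[OF supermodule_isomorphic_sym[OF sm[OF M]
            sm[OF simple_atypical_parity_change[OF N]] that]]
      by (simp add: parity_change_parity_change)
    then show "(N, M) \<in> iso_up_to_parity"
      using MN supermodule_isomorphic_sym[OF sm[OF M] sm[OF N]] by (auto simp: iso_up_to_parity_def)
  qed
  show "trans (iso_up_to_parity :: (('k, 'v) smod \<times> ('k, 'v) smod) set)"
  proof (rule transI)
    fix M N K :: "('k, 'v) smod"
    assume MN: "(M, N) \<in> iso_up_to_parity" and NK: "(N, K) \<in> iso_up_to_parity"
    consider "supermodule_isomorphic sq2 M N" | "supermodule_isomorphic sq2 M (parity_change N)"
      using MN by (auto simp: iso_up_to_parity_def)
    then have "supermodule_isomorphic sq2 M K \<or> supermodule_isomorphic sq2 M (parity_change K)"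
    proof cases
      case 1
      then show ?thesis
        using NK supermodule_isomorphic_trans by (auto simp: iso_up_to_parity_def)
    next
      case 2
      have "supermodule_isomorphic sq2 (parity_change N) (parity_change K) \<or>
          supermodule_isomorphic sq2 (parity_change N) K"
        using NK supermodule_isomorphic_parity_change[of sq2 N]
        by (auto simp: iso_up_to_parity_def) (metis parity_change_parity_change)
      then show ?thesis
        using 2 supermodule_isomorphic_trans by blast
    qed
    then show "(M, K) \<in> iso_up_to_parity"
      using MN NK by (simp add: iso_up_to_parity_def)
  qed
qed (auto simp: iso_up_to_parity_def refl_on_def supermodule_isomorphic_refl)

text \<open>Between purely even modules the alternative with parity change cannot occur, and both
  actions factor through \<open>sl_part\<close>, so that the \<open>sq2\<close>-homomorphisms and
  the \<open>sl2\<close>-homomorphisms are the same functions.\<close>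

lemma iso_up_to_parity_iff_iso_sl2:
  fixes M N :: "('k::field_char_0, 'v) smod"
  assumes M: "M \<in> simple_atypical" "purely_even M" and N: "N \<in> simple_atypical" "purely_even N"
  shows "(M, N) \<in> iso_up_to_parity \<longleftrightarrow> (Res sl2 M, Res sl2 N) \<in> iso_sl2"
proof -
  have sM: "simple_supermodule sq2 M" "atypical M" and sN: "simple_supermodule sq2 N" "atypical N"
    using M N by (auto simp: simple_atypical_def)
  interpret M: supermodule sq2 M
    using sM by (simp add: simple_supermodule_def)
  interpret N: supermodule sq2 N
    using sN by (simp add: simple_supermodule_def)
  have not_odd: "\<not> supermodule_isomorphic sq2 M (parity_change N)"
  proof
    assume "supermodule_isomorphic sq2 M (parity_change N)"
    then obtain f where f: "f \<in> supermodule_hom sq2 M (parity_change N)"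
        and bij: "bij_betw f (carrier M) (carrier N)"
      by (auto simp: supermodule_isomorphic_def)
    \<comment> \<open>All of \<open>M\<close> has parity 0, while the component of parity 0 of
      \<open>parity_change N\<close> is \<open>part N 1\<close>, which is zero. A surjective
      \<open>f\<close> would force \<open>N\<close> to be zero.\<close>
    have "part M 0 = carrier M"
      using M.part_carrier_or_zero[of 0] M(2) by (simp add: purely_even_def)
    moreover have "f ` part M 0 \<subseteq> part (parity_change N) 0"
      using f unfolding supermodule_hom_def by blast
    ultimately have "carrier N \<subseteq> {\<zero>\<^bsub>N\<^esub>}"
      using bij N(2) by (simp add: purely_even_def bij_betw_def)
    then show False
      using sN(1) N.M.zero_closed unfolding simple_supermodule_def by blast
  qed
  have "f \<in> supermodule_hom sq2 M N \<longleftrightarrow> f \<in> supermodule_hom sl2 (Res sl2 M) (Res sl2 N)" for f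
  proof
    assume "f \<in> supermodule_hom sq2 M N"
    then show "f \<in> supermodule_hom sl2 (Res sl2 M) (Res sl2 N)"
      using total_sl2_subset by (auto simp: supermodule_hom_def hom_def Res_def)
  next
    assume f: "f \<in> supermodule_hom sl2 (Res sl2 M) (Res sl2 N)"
    have "f (act M X v) = act N X (f v)" if "X \<in> total sq2" "v \<in> carrier M" for X v
    proof -
      have "f v \<in> carrier N"
        using f that by (auto simp: supermodule_hom_def hom_def Res_def)
      moreover have "f (act M (sl_part X) v) = act N (sl_part X) (f v)"
        using f that(2) sl_part_in_total[of X] by (auto simp: supermodule_hom_def Res_def)
      ultimately show ?thesis
        using act_sl_part[OF sM that] act_sl_part[OF sN that(1)] by simp
    qed
    then show "f \<in> supermodule_hom sq2 M N"
      using f by (simp add: supermodule_hom_def hom_def Res_def)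
  qed
  then have "supermodule_hom sq2 M N = supermodule_hom sl2 (Res sl2 M) (Res sl2 N)"
    by blast
  then have "supermodule_isomorphic sq2 M N \<longleftrightarrow> supermodule_isomorphic sl2 (Res sl2 M) (Res sl2 N)"
    by (simp add: supermodule_isomorphic_def)
  then show ?thesis
    using not_odd M N by (simp add: iso_up_to_parity_def iso_sl2_def Res_in_simple_even_sl2)
qed

text \<open>\<open>P\<close> meets every class of \<open>r\<close>; on \<open>P\<close> the map
  \<open>g\<close> respects and reflects the relations and reaches every class of \<open>s\<close>.
  These are the conditions for \<open>g\<close> to induce a bijection of the quotients, although
  \<open>g\<close> is controlled only on \<open>P\<close>.\<close>

lemma quotient_bij_betw:
  assumes r: "equiv A r" and s: "equiv B s"
    and P: "P \<subseteq> A" "\<And>a. a \<in> A \<Longrightarrow> \<exists>b\<in>P. (a, b) \<in> r"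
    and g: "g ` P \<subseteq> B" "\<And>a b. a \<in> P \<Longrightarrow> b \<in> P \<Longrightarrow> (a, b) \<in> r \<longleftrightarrow> (g a, g b) \<in> s"
      "\<And>b. b \<in> B \<Longrightarrow> \<exists>a\<in>P. (g a, b) \<in> s"
  shows "\<exists>\<Phi>. bij_betw \<Phi> (A // r) (B // s) \<and> (\<forall>C\<in>A // r. \<forall>a\<in>C \<inter> P. \<Phi> C = s `` {g a})"
proof -
  \<comment> \<open>Using all representatives in \<open>C \<inter> P\<close> at once avoids a
    choice; their images are equivalent, so the result is a single class.\<close>
  define \<Phi> where "\<Phi> C = s `` (g ` (C \<inter> P))" for C
  have class_P: "\<exists>a\<in>P. C = r `` {a}" if C: "C \<in> A // r" for C
  proof -
    obtain a where a: "a \<in> A" "C = r `` {a}"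
      using C by (rule quotientE)
    then obtain b where "b \<in> P" "(a, b) \<in> r"
      using P(2) by blast
    then show ?thesis
      using a equiv_class_eq[OF r] by blast
  qed
  have \<Phi>_class: "\<Phi> (r `` {a}) = s `` {g a}" if a: "a \<in> P" for a
  proof -
    have "s `` {g b} = s `` {g a}" if "b \<in> r `` {a} \<inter> P" for b
      using that a g(2)[of a b] equiv_class_eq[OF s] by fastforce
    moreover have "a \<in> r `` {a} \<inter> P"
      using a P(1) equiv_class_self[OF r] by blast
    ultimately show ?thesis
      unfolding \<Phi>_def by blast
  qed
  have "bij_betw \<Phi> (A // r) (B // s)"
    unfolding bij_betw_def
  proof (intro conjI inj_onI)
    fix C D
    assume C: "C \<in> A // r" and D: "D \<in> A // r" and eq: "\<Phi> C = \<Phi> D"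
    obtain a where a: "a \<in> P" "C = r `` {a}"
      using class_P[OF C] by blast
    obtain b where b: "b \<in> P" "D = r `` {b}"
      using class_P[OF D] by blast
    have "s `` {g a} = s `` {g b}"
      using eq a b \<Phi>_class by simp
    then have "(g a, g b) \<in> s"
      using b g(1) eq_equiv_class[OF _ s] by blast
    then have "(a, b) \<in> r"
      using a b g(2) by blast
    then show "C = D"
      using a b equiv_class_eq[OF r] by blast
  next
    have "D \<in> B // s" if D: "D \<in> \<Phi> ` (A // r)" for D
    proof -
      obtain C where "C \<in> A // r" "D = \<Phi> C"
        using D by blast
      then obtain a where "a \<in> P" "D = s `` {g a}"
        using class_P[of C] \<Phi>_class by blast
      then show ?thesis
        using g(1) quotientI[of "g a" B s] by blast
    qed
    moreover have "D \<in> \<Phi> ` (A // r)" if D: "D \<in> B // s" for D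
    proof -
      obtain b where b: "b \<in> B" "D = s `` {b}"
        using D by (rule quotientE)
      then obtain a where a: "a \<in> P" "(g a, b) \<in> s"
        using g(3) by blast
      then have "D = \<Phi> (r `` {a})"
        using b equiv_class_eq[OF s] \<Phi>_class by simp
      then show ?thesis
        using a P(1) quotientI[of a A r] by blast
    qed
    ultimately show "\<Phi> ` (A // r) = B // s"
      by blast
  qed
  moreover have "\<Phi> C = s `` {g a}" if C: "C \<in> A // r" and a: "a \<in> C \<inter> P" for C a
  proof -
    obtain b where b: "C = r `` {b}"
      using class_P[OF C] by blast
    then have "(b, a) \<in> r"
      using a by blast
    then have "C = r `` {a}"
      using b equiv_class_eq[OF r] by blast
    then show ?thesis
      using \<Phi>_class a by blast
  qed
  ultimately show ?thesis
    by blast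
qed

text \<open>The first conjunct provides each class with a suitable representative, so the formula in
  the last one determines \<open>\<Phi>\<close> on \<open>S\<close>. One carrier type serves both
  sides because \<open>Res\<close> and \<open>inflate\<close> keep the carrier.\<close>

theorem proposition28:
  fixes S :: "('k::{alg_closed_field, field_char_0}, 'v) smod set set"
    and T :: "('k, 'v) smod set set"
  assumes "uncountable (UNIV :: 'k set)"
    and "S = simple_atypical // iso_up_to_parity"
    and "T = simple_even_sl2 // iso_sl2"
  shows "(\<forall>C\<in>S. \<exists>M\<in>C. Res sl2 M \<in> simple_even_sl2) \<and>
    (\<exists>\<Phi>. bij_betw \<Phi> S T \<and>
      (\<forall>C\<in>S. \<forall>M\<in>C. Res sl2 M \<in> simple_even_sl2 \<longrightarrow> \<Phi> C = iso_sl2 `` {Res sl2 M}))"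
proof -
  define P where "P = {M :: ('k, 'v) smod. M \<in> simple_atypical \<and> purely_even M}"
  have P_Res: "M \<in> P \<longleftrightarrow> Res sl2 M \<in> simple_even_sl2" if "M \<in> simple_atypical" for M
    using that by (simp add: P_def Res_in_simple_even_sl2)
  have rep: "\<exists>N\<in>P. (M, N) \<in> iso_up_to_parity" if M: "M \<in> simple_atypical" for M :: "('k, 'v) smod"
  proof (cases "purely_even M")
    case True
    then show ?thesis
      using M by (auto simp: P_def iso_up_to_parity_def supermodule_isomorphic_refl)
  next
    case False
    then have "parity_change M \<in> P"
      using M purely_even_or_parity_change simple_atypical_parity_change
      by (auto simp: P_def simple_atypical_def)
    \<comment> \<open>This is the second alternative in \<open>iso_up_to_parity\<close> with
      \<open>parity_change M\<close> as the representative.\<close>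
    moreover have "supermodule_isomorphic sq2 M (parity_change (parity_change M))"
      by (simp only: parity_change_parity_change supermodule_isomorphic_refl)
    ultimately show ?thesis
      using M by (auto simp: P_def iso_up_to_parity_def)
  qed
  have "\<exists>\<Phi>. bij_betw \<Phi> S T \<and> (\<forall>C\<in>S. \<forall>M\<in>C \<inter> P. \<Phi> C = iso_sl2 `` {Res sl2 M})"
    unfolding assms(2,3)
  \<comment> \<open>The representatives are the purely even modules in \<open>P\<close> and the map
    is \<open>Res sl2\<close>; \<open>inflate\<close> supplies the preimages.\<close>
  proof (rule quotient_bij_betw[OF equiv_iso_up_to_parity equiv_iso_sl2])
    fix N :: "('k, 'v) smod"
    assume N: "N \<in> simple_even_sl2"
    then have "inflate N \<in> P"
      by (simp add: P_def inflate_simple_atypical simple_even_sl2_def)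
    moreover from this have "(Res sl2 (inflate N), N) \<in> iso_sl2"
      using N Res_inflate_isomorphic[of N] P_Res[of "inflate N"] by (simp add: iso_sl2_def P_def)
    ultimately show "\<exists>M\<in>P. (Res sl2 M, N) \<in> iso_sl2"
      by blast
  qed (use rep P_Res iso_up_to_parity_iff_iso_sl2 in \<open>auto simp: P_def\<close>)
  then obtain \<Phi> where bij: "bij_betw \<Phi> S T"
    and \<Phi>: "\<And>C M. C \<in> S \<Longrightarrow> M \<in> C \<inter> P \<Longrightarrow> \<Phi> C = iso_sl2 `` {Res sl2 M}"
    by blast
  have sub: "C \<subseteq> simple_atypical" if "C \<in> S" for C
    using in_quotient_imp_subset[OF equiv_iso_up_to_parity] that unfolding assms(2) .
  have rep_class: "\<exists>M\<in>C. Res sl2 M \<in> simple_even_sl2" if C: "C \<in> S" for C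
  proof -
    obtain M where M: "M \<in> simple_atypical" "C = iso_up_to_parity `` {M}"
      using C unfolding assms(2) by (rule quotientE)
    obtain N where N: "N \<in> P" "(M, N) \<in> iso_up_to_parity"
      using rep[OF M(1)] by (rule bexE)
    then have "N \<in> C"
      using M(2) by simp
    moreover from this have "Res sl2 N \<in> simple_even_sl2"
      using N(1) P_Res subsetD[OF sub[OF C]] by simp
    ultimately show ?thesis
      by (rule bexI[rotated])
  qed
  have "\<Phi> C = iso_sl2 `` {Res sl2 M}" if "C \<in> S" "M \<in> C" "Res sl2 M \<in> simple_even_sl2" for C M
    using \<Phi>[OF that(1)] P_Res[OF subsetD[OF sub[OF that(1)] that(2)]] that(2,3) by simp
  with bij rep_class show ?thesis
    by (intro conjI ballI exI[of _ \<Phi>] impI)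
qed

end
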